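(* Let $A\neq B$ be strings of length $n\ge 1$ over $\{\mathrm{H},\mathrm{T}\}$. If there exists $p$ with $1\le p\le n$ such that $$h_A(p)+1<h_B(p)\quad\text{and}\quad t_B(p)+1<t_A(p),$$ or $$h_B(p)+1<h_A(p)\quad\text{and}\quad t_A(p)+1<t_B(p),$$ then the No-Flippancy game with Alice's string $A$ and Bob's string $B$ is infinite.
   Context: No-Flippancy game: Alice and Bob have distinct strings $A=A_1\cdots A_n$ and $B=B_1\cdots B_n$ of the same length $n$ over the alphabet $\{\mathrm{H},\mathrm{T}\}$. Starting from the empty sequence, the players alternate turns, Alice going first, and on each turn the current player appends one letter to the sequence (the game output) as follows: let $i<n$ be the maximal length of a suffix of the current sequence that coincides with a prefix of the current player's string ($i=0$ is allowed, via the empty suffix); the player appends the letter with index $i+1$ of their own string. The game ends as soon as $A$ or $B$ appears as a block of consecutive letters in the sequence (necessarily as its suffix, no matter who made the last move); the player whose string appears first wins. If neither string ever appears, the game is infinite. Notation: for $1\le p\le n$, $h_A(p)$ (respectively $t_A(p)$) is the length of the longest block of consecutive $\mathrm{H}$s (respectively $\mathrm{T}$s) in the prefix $A_1\cdots A_p$ (it is $0$ if the letter does not occur); $h_B(p)$ and $t_B(p)$ are defined in the same way for $B$. *)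

theory Defs
  imports Main "HOL-Library.Sublist"
begin

datatype coin = H | T

text \<open>Length of the longest block of consecutive letters c in xs; the value is 0 if c
  does not occur, since the empty block always qualifies.\<close>

definition longest_run :: "coin \<Rightarrow> coin list \<Rightarrow> nat" where
  "longest_run c xs = Max {k. sublist (replicate k c) xs}"

text \<open>Only proper prefixes of the player's string P are considered. For nonempty P the set
  contains 0, so the maximum is meaningful.\<close>

definition overlap :: "coin list \<Rightarrow> coin list \<Rightarrow> nat" where
  "overlap P s = Max {i. i < length P \<and> suffix (take i P) s}"

text \<open>Lists are indexed from 0, so the letter number i + 1 of P is P ! i.\<close>

definition next_letter :: "coin list \<Rightarrow> coin list \<Rightarrow> coin" where
  "next_letter P s = P ! overlap P s"

definition game_over :: "coin list \<Rightarrow> coin list \<Rightarrow> coin list \<Rightarrow> bool" where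
  "game_over A B s \<longleftrightarrow> sublist A s \<or> sublist B s"

text \<open>The game output after at most k turns; it stays constant once the game has ended.
  The turns are numbered 0, 1, 2, ..., and Alice, whose string is A, has the even ones.\<close>

fun game_output :: "coin list \<Rightarrow> coin list \<Rightarrow> nat \<Rightarrow> coin list" where
  "game_output A B 0 = []"
| "game_output A B (Suc k) =
     (let s = game_output A B k
      in if game_over A B s then s
         else s @ [next_letter (if even k then A else B) s])"

definition infinite_game :: "coin list \<Rightarrow> coin list \<Rightarrow> bool" where
  "infinite_game A B \<longleftrightarrow> (\<forall>k. \<not> game_over A B (game_output A B k))"

end

theory Submission
  imports Defs
begin

text \<open>Up to exchanging the two letters, the condition says that the runs of the letter c in
  Alice's prefix of length p are at most x letters long, those of d in Bob's prefix are at most y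
  letters long, and that Bob's prefix contains c repeated x + 2 times and Alice's contains d
  repeated y + 2 times. While neither of these two long runs has been output, neither prefix of
  length p has been output either, so both players only use letters of these prefixes. Then Alice
  never extends a run of x letters c: the extended run would end in a prefix of her string, which
  is either too long to respect the bound x or a block of c's that was not the longest overlap.
  Likewise for Bob and d. Completing one of the long runs would take two moves in a row by the
  same player, hence neither ever appears.\<close>

text \<open>The lengths of blocks of \<open>c\<close> in \<open>xs\<close> are finite in number and
  closed downwards, so every later use of the maximum goes through this equivalence.\<close>

lemma sublist_replicate_iff_le_longest_run:
  "sublist (replicate k c) xs \<longleftrightarrow> k \<le> longest_run c xs"
proof -
  let ?K = "{k. sublist (replicate k c) xs}"
  have fin: "finite ?K"
    by (rule finite_subset[of _ "{..length xs}"]) (auto dest: sublist_length_le)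
  have max: "sublist (replicate (longest_run c xs) c) xs"
  proof -
    have "0 \<in> ?K"
      by simp
    then have "Max ?K \<in> ?K"
      using Max_in[OF fin] by blast
    then show ?thesis
      by (simp add: longest_run_def)
  qed
  show ?thesis
  proof
    assume "k \<le> longest_run c xs"
    then have "prefix (replicate k c) (replicate (longest_run c xs) c)"
      by (auto simp: prefix_def le_iff_add replicate_add)
    from sublist_order.order_trans[OF prefix_imp_sublist[OF this] max]
    show "sublist (replicate k c) xs" .
  qed (use Max_ge[OF fin] in \<open>simp add: longest_run_def\<close>)
qed

lemma suffix_take_overlap:
  assumes "P \<noteq> []"
  shows "overlap P s < length P" and "suffix (take (overlap P s) P) s"
proof -
  let ?I = "{i. i < length P \<and> suffix (take i P) s}"
  have "0 \<in> ?I"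
    using assms by simp
  then have "overlap P s \<in> ?I"
    unfolding overlap_def by (intro Max_in) auto
  then show "overlap P s < length P" and "suffix (take (overlap P s) P) s"
    by auto
qed

lemma le_overlap:
  assumes "i < length P" and "suffix (take i P) s"
  shows "i \<le> overlap P s"
  unfolding overlap_def by (rule Max_ge) (use assms in auto)

lemma replicate_Suc_snoc: "replicate (Suc k) c = replicate k c @ [c]"
  by (simp add: replicate_append_same)

lemma prefix_take_take:
  assumes "i \<le> j"
  shows "prefix (take i xs) (take j xs)"
  using take_is_prefix[of i "take j xs"] assms by (simp add: min.absorb1)

lemma next_letter_neq:
  assumes p: "p \<le> length P"
    and new: "\<not> sublist (take p P) s"
    and less: "longest_run c (take p P) < p"
    and run: "suffix (replicate (longest_run c (take p P)) c) s"
  shows "next_letter P s \<noteq> c"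
proof
  assume next_c: "next_letter P s = c"
  let ?r = "longest_run c (take p P)"
  define i where "i = overlap P s"
  have "P \<noteq> []"
    using p less by auto
  then have i: "i < length P" "suffix (take i P) s"
    using suffix_take_overlap i_def by auto
  have "i < p"
  proof (rule ccontr)
    assume "\<not> i < p"
    then have "prefix (take p P) (take i P)"
      by (intro prefix_take_take) simp
    from sublist_order.order_trans[OF prefix_imp_sublist[OF this] suffix_imp_sublist[OF i(2)]] new
    show False by simp
  qed
  have take_Suc: "take (Suc i) P = take i P @ [c]"
    using next_c i(1) by (simp add: next_letter_def i_def take_Suc_conv_app_nth)
  show False
  proof (cases "?r \<le> i")
    \<comment> \<open>The overlap covers the final run of \<open>s\<close>, so the letter
      \<open>c\<close> after it would give \<open>take p P\<close> a run of length
      \<open>?r + 1\<close>.\<close>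
    case True
    then have "suffix (replicate ?r c) (take i P)"
      using i(1) by (intro suffix_length_suffix[OF run i(2)]) simp
    then have suf: "suffix (replicate (Suc ?r) c) (take (Suc i) P)"
      unfolding replicate_Suc_snoc take_Suc by simp
    have pre: "prefix (take (Suc i) P) (take p P)"
      using \<open>i < p\<close> by (intro prefix_take_take) simp
    from sublist_order.order_trans[OF suffix_imp_sublist[OF suf] prefix_imp_sublist[OF pre]]
    show False
      by (simp add: sublist_replicate_iff_le_longest_run del: replicate_Suc)
  next
    \<comment> \<open>The overlap lies inside the final run, so lengthening it by \<open>c\<close>
      still gives a suffix of \<open>s\<close>. Since \<open>Suc i \<le> ?r < p\<close>, this is a
      proper prefix of \<open>P\<close> and competes for the maximal overlap.\<close>
    case False
    then have "suffix (take i P) (replicate ?r c)"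
      by (intro suffix_length_suffix[OF i(2) run]) simp
    then have "take i P = replicate i c"
      using i(1) by (intro replicate_eqI) (auto dest!: set_mono_suffix split: if_splits)
    then have "take (Suc i) P = replicate (Suc i) c"
      unfolding replicate_Suc_snoc take_Suc by simp
    moreover have "suffix (replicate (Suc i) c) (replicate ?r c)"
    proof -
      have "replicate ?r c = replicate (?r - Suc i) c @ replicate (Suc i) c"
        unfolding replicate_add[symmetric] using False by simp
      then show ?thesis
        by (rule suffixI)
    qed
    ultimately have "suffix (take (Suc i) P) (replicate ?r c)"
      by (simp only:)
    from suffix_order.order_trans[OF this run] have "suffix (take (Suc i) P) s" .
    then have "Suc i \<le> i"
      using le_overlap[of "Suc i" P s] False less p by (simp add: i_def)
    then show False
      by simp
  qed
qed

definition avoids :: "coin \<Rightarrow> nat \<Rightarrow> coin list \<Rightarrow> bool" where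
  "avoids c k s \<longleftrightarrow> \<not> sublist (replicate k c) s"

text \<open>This serves twice: it keeps the overlap of the moving player below \<open>p\<close>, and
  it shows that the game is not over.\<close>

lemma avoids_imp_not_sublist:
  assumes "avoids c k s" and "k \<le> longest_run c (take p P)"
  shows "\<not> sublist (take p P) s"
  using assms(1) sublist_order.order_trans[OF assms(2)[folded sublist_replicate_iff_le_longest_run]]
  by (auto simp: avoids_def)

text \<open>The player of P is about to move; the last hypothesis and the last conclusion record that
  the player who has just moved never makes the first of the two moves completing a long run.\<close>

lemma avoids_next_letter:
  assumes p: "p \<le> length P" and "c \<noteq> d"
    and runs: "longest_run c (take p P) = x" "y + 2 \<le> longest_run d (take p P)"
    and avoid: "avoids c (x + 2) s" "avoids d (y + 2) s"
    and last: "\<not> suffix (replicate (y + 1) d) s"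
  defines "s' \<equiv> s @ [next_letter P s]"
  shows "avoids c (x + 2) s'" and "avoids d (y + 2) s'" and "\<not> suffix (replicate (x + 1) c) s'"
proof -
  \<comment> \<open>Otherwise \<open>take p P\<close> would consist of \<open>c\<close> alone,
    although it contains \<open>d\<close>.\<close>
  have "x < p"
  proof (rule ccontr)
    assume "\<not> x < p"
    then have "sublist (replicate p c) (take p P)"
      using runs(1) by (simp add: sublist_replicate_iff_le_longest_run)
    then obtain ps ss where split: "take p P = ps @ replicate p c @ ss"
      by (auto simp: sublist_def)
    from arg_cong[OF this, of length] have "ps = []" "ss = []"
      using p by simp_all
    with split have "replicate p c = take p P"
      by simp
    moreover have "sublist (replicate 1 d) (take p P)"
      using runs(2) unfolding sublist_replicate_iff_le_longest_run by simp
    ultimately have "d \<in> set (replicate p c)"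
      using set_mono_sublist by fastforce
    with \<open>c \<noteq> d\<close> show False
      by (simp split: if_splits)
  qed
  have snoc: "suffix (replicate (Suc k) e) s' \<longleftrightarrow> next_letter P s = e \<and> suffix (replicate k e) s"
    for k e
    unfolding replicate_Suc_snoc s'_def by auto
  show no_c: "\<not> suffix (replicate (x + 1) c) s'"
    using next_letter_neq[OF p avoids_imp_not_sublist[OF avoid(2) runs(2)], of c] runs(1) \<open>x < p\<close> snoc
    by auto
  have "suffix (replicate (x + 1) c) (replicate (x + 2) c)"
    by (simp add: suffix_Cons)
  then have "\<not> suffix (replicate (x + 2) c) s'"
    using no_c suffix_order.order_trans[of _ _ s'] by blast
  with avoid(1) show "avoids c (x + 2) s'"
    by (simp add: avoids_def s'_def sublist_snoc)
  \<comment> \<open>One move can complete this run only if \<open>s\<close> already ends in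
    \<open>y + 1\<close> letters \<open>d\<close>.\<close>
  have "\<not> suffix (replicate (y + 2) d) s'"
    using last snoc[of "y + 1" d] by simp
  with avoid(2) show "avoids d (y + 2) s'"
    by (simp add: avoids_def s'_def sublist_snoc)
qed

lemma infinite_game_if_runs:
  assumes p: "p \<le> length A" "p \<le> length B" and "c \<noteq> d"
    and A: "longest_run c (take p A) + 1 < longest_run c (take p B)"
    and B: "longest_run d (take p B) + 1 < longest_run d (take p A)"
  shows "infinite_game A B"
proof -
  define x y where "x = longest_run c (take p A)" and "y = longest_run d (take p B)"
  have x: "x + 2 \<le> longest_run c (take p B)" and y: "y + 2 \<le> longest_run d (take p A)"
    using A B by (simp_all add: x_def y_def)
  have not_over: "\<not> game_over A B s" if "avoids c (x + 2) s" "avoids d (y + 2) s" for s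
    using avoids_imp_not_sublist[OF that(1) x] avoids_imp_not_sublist[OF that(2) y]
      sublist_order.order_trans[OF prefix_imp_sublist[OF take_is_prefix]]
    unfolding game_over_def by blast
  \<comment> \<open>For even \<open>k > 0\<close> Bob has just moved, for odd \<open>k\<close>
    Alice. At \<open>k = 0\<close> the last clause holds because the output is empty.\<close>
  have "avoids c (x + 2) (game_output A B k) \<and> avoids d (y + 2) (game_output A B k) \<and>
      (if even k then \<not> suffix (replicate (y + 1) d) (game_output A B k)
       else \<not> suffix (replicate (x + 1) c) (game_output A B k))" for k
  proof (induction k)
    case 0
    show ?case
      by (simp add: avoids_def)
  next
    case (Suc k)
    define s where "s = game_output A B k"
    have avoid: "avoids c (x + 2) s" "avoids d (y + 2) s"
      using Suc unfolding s_def by blast+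
    have step: "game_output A B (Suc k) = s @ [next_letter (if even k then A else B) s]"
      using not_over[OF avoid] by (simp add: Let_def s_def)
    show ?case
    proof (cases "even k")
      case True
      then have "\<not> suffix (replicate (y + 1) d) s"
        using Suc unfolding s_def by presburger
      from avoids_next_letter[OF p(1) \<open>c \<noteq> d\<close> x_def[symmetric] y avoid this]
      show ?thesis
        unfolding step using True by simp
    next
      case False
      then have "\<not> suffix (replicate (x + 1) c) s"
        using Suc unfolding s_def by presburger
      \<comment> \<open>Bob's move is Alice's with \<open>c\<close>, \<open>x\<close> and
        \<open>d\<close>, \<open>y\<close> exchanged.\<close>
      from avoids_next_letter[OF p(2) \<open>c \<noteq> d\<close>[symmetric] y_def[symmetric] x avoid(2,1) this]
      show ?thesis
        unfolding step using False by simp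
    qed
  qed
  with not_over show ?thesis
    unfolding infinite_game_def by blast
qed

theorem theorem14:
  fixes A B :: "coin list" and n :: nat
  assumes "n \<ge> 1"
    and "length A = n"
    and "length B = n"
    and "A \<noteq> B"
    and "\<exists>p. 1 \<le> p \<and> p \<le> n \<and>
          ((longest_run H (take p A) + 1 < longest_run H (take p B) \<and>
            longest_run T (take p B) + 1 < longest_run T (take p A)) \<or>
           (longest_run H (take p B) + 1 < longest_run H (take p A) \<and>
            longest_run T (take p A) + 1 < longest_run T (take p B)))"
  shows "infinite_game A B"
proof -
  from assms(5) obtain p where p: "p \<le> length A" "p \<le> length B"
    and runs: "(longest_run H (take p A) + 1 < longest_run H (take p B) \<and>
        longest_run T (take p B) + 1 < longest_run T (take p A)) \<or>
      (longest_run H (take p B) + 1 < longest_run H (take p A) \<and>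
        longest_run T (take p A) + 1 < longest_run T (take p B))"
    unfolding assms(2,3) by blast
  \<comment> \<open>The second alternative is the first with the two letters exchanged, that is,
    with \<open>T\<close> for \<open>c\<close> and \<open>H\<close> for \<open>d\<close>.\<close>
  from runs show ?thesis
    using infinite_game_if_runs[OF p coin.distinct(1)] infinite_game_if_runs[OF p coin.distinct(2)]
    by blast
qed

end
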